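(* The following $m$-equivalences hold: $\{121,1233\}\sim\{121,2133\}$ and $\{112,1233\}\sim\{112,2133\}$.
   Context: A (finite, reduced) multiset is $S=1^{a_1}2^{a_2}\cdots k^{a_k}$ with $k\ge 1$ and all $a_i\ge 1$, meaning that $i$ occurs with multiplicity $a_i$. A multipermutation of $S$ is a word having exactly $a_i$ occurrences of each letter $i\in[k]=\{1,\dots,k\}$ and no other letters. A word $\pi=\pi_1\cdots\pi_n$ contains a pattern (word) $\rho=\rho_1\cdots\rho_\ell$ if there are indices $i(1)<\cdots<i(\ell)$ such that for all $a,b\in[\ell]$: $\pi_{i(a)}<\pi_{i(b)}$ iff $\rho_a<\rho_b$, and $\pi_{i(a)}>\pi_{i(b)}$ iff $\rho_a>\rho_b$; otherwise $\pi$ avoids $\rho$. For a set $P$ of patterns, $\mathrm{av}(S;P)$ is the number of multipermutations of $S$ that avoid every pattern in $P$. Two sets of patterns $P,Q$ are $m$-equivalent, written here $P\sim Q$, if $\mathrm{av}(S;P)=\mathrm{av}(S;Q)$ for every multiset $S$. *)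

theory Defs
  imports "HOL-Combinatorics.Multiset_Permutations"
begin

text \<open>Words are lists over \<^typ>\<open>nat\<close>; positions are counted from 0, letters from 1.\<close>

definition reduced_multiset :: "nat multiset \<Rightarrow> bool" where
  "reduced_multiset S \<longleftrightarrow> (\<exists>k\<ge>1. set_mset S = {1..k})"

definition contains_pattern :: "nat list \<Rightarrow> nat list \<Rightarrow> bool" where
  "contains_pattern \<pi> \<rho> \<longleftrightarrow>
     (\<exists>i :: nat \<Rightarrow> nat.
        strict_mono_on {..<length \<rho>} i \<and>
        i ` {..<length \<rho>} \<subseteq> {..<length \<pi>} \<and>
        (\<forall>a<length \<rho>. \<forall>b<length \<rho>.
           (\<pi> ! i a < \<pi> ! i b \<longleftrightarrow> \<rho> ! a < \<rho> ! b) \<and>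
           (\<pi> ! i a > \<pi> ! i b \<longleftrightarrow> \<rho> ! a > \<rho> ! b)))"

abbreviation avoids_pattern :: "nat list \<Rightarrow> nat list \<Rightarrow> bool" where
  "avoids_pattern \<pi> \<rho> \<equiv> \<not> contains_pattern \<pi> \<rho>"

definition av :: "nat multiset \<Rightarrow> nat list set \<Rightarrow> nat" where
  "av S P = card {\<pi> \<in> permutations_of_multiset S. \<forall>\<rho>\<in>P. avoids_pattern \<pi> \<rho>}"

definition m_equivalent :: "nat list set \<Rightarrow> nat list set \<Rightarrow> bool" where
  "m_equivalent P Q \<longleftrightarrow> (\<forall>S. reduced_multiset S \<longrightarrow> av S P = av S Q)"

end

theory Submission
  imports Defs "HOL-Library.Sublist"
begin

text \<open>
  Words avoiding 121 (or 112) arise by inserting the letters from the largest down to the smallest: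
  the copies of the new minimum form one contiguous block (or, for 112, all but the first of them
  stand at the very end), so a word is described by the sequence of insertion positions.
  A position \<open>p\<close> may be used without creating 1233 iff the suffix from \<open>p\<close> avoids 122, and without
  creating 2133 iff no letter before \<open>p\<close> is smaller than a letter repeated after \<open>p\<close>. Label a word by
  the number of its admissible positions and the number of positions whose suffix has no repeated
  letter. For both patterns the multiset of labels of the children of a word depends on its label
  in the same way: the two generating trees coincide, although the admissible positions in front
  of the last repetition are matched in reverse order.
\<close>

subsection \<open>Pattern containment and subsequences\<close>

text \<open>Links the index functions in the definition of containment with the inductive
  \<open>subseq\<close>, whose rules carry all later arguments.\<close>

lemma subseq_iff_index:
  "subseq \<tau> \<pi> \<longleftrightarrow> (\<exists>i. strict_mono_on {..<length \<tau>} i \<and> i ` {..<length \<tau>} \<subseteq> {..<length \<pi>} \<and>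
     \<tau> = map (\<lambda>a. \<pi> ! i a) [0..<length \<tau>])"
proof
  assume "subseq \<tau> \<pi>"
  then show "\<exists>i. strict_mono_on {..<length \<tau>} i \<and> i ` {..<length \<tau>} \<subseteq> {..<length \<pi>} \<and>
     \<tau> = map (\<lambda>a. \<pi> ! i a) [0..<length \<tau>]"
  proof (induction rule: list_emb.induct)
    case (list_emb_Nil ys)
    then show ?case by simp
  next
    case (list_emb_Cons xs ys y)
    then obtain i where i: "strict_mono_on {..<length xs} i" "i ` {..<length xs} \<subseteq> {..<length ys}"
      "xs = map (\<lambda>a. ys ! i a) [0..<length xs]" by blast
    have "xs = map (\<lambda>a. (y # ys) ! (Suc \<circ> i) a) [0..<length xs]" using i(3) by simp
    moreover have "strict_mono_on {..<length xs} (Suc \<circ> i)"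
      using i(1) by (simp add: strict_mono_on_def)
    moreover have "(Suc \<circ> i) ` {..<length xs} \<subseteq> {..<length (y # ys)}"
      using i(2) by auto
    ultimately show ?case by blast
  next
    case (list_emb_Cons2 x y xs ys)
    then obtain i where i: "strict_mono_on {..<length xs} i" "i ` {..<length xs} \<subseteq> {..<length ys}"
      "xs = map (\<lambda>a. ys ! i a) [0..<length xs]" by blast
    define j where "j = case_nat 0 (Suc \<circ> i)"
    have "x # xs = map (\<lambda>a. (y # ys) ! j a) [0..<length (x # xs)]"
    proof -
      have "map (\<lambda>a. (y # ys) ! j a) [0..<length (x # xs)]
        = y # map (\<lambda>a. ys ! i a) [0..<length xs]"
        unfolding length_Cons by (subst map_upt_Suc) (simp add: j_def)
      then show ?thesis using i(3) list_emb_Cons2(1) by simp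
    qed
    moreover have "strict_mono_on {..<length (x # xs)} j"
      using i(1) by (auto simp: strict_mono_on_def j_def split: nat.splits)
    moreover have "j ` {..<length (x # xs)} \<subseteq> {..<length (y # ys)}"
      using i(2) by (fastforce simp: j_def split: nat.splits)
    ultimately show ?case by (intro exI[of _ j] conjI)
  qed
next
  assume "\<exists>i. strict_mono_on {..<length \<tau>} i \<and> i ` {..<length \<tau>} \<subseteq> {..<length \<pi>} \<and>
     \<tau> = map (\<lambda>a. \<pi> ! i a) [0..<length \<tau>]"
  then obtain i where i: "strict_mono_on {..<length \<tau>} i" "i ` {..<length \<tau>} \<subseteq> {..<length \<pi>}"
    "\<tau> = map (\<lambda>a. \<pi> ! i a) [0..<length \<tau>]" by blast
  \<comment> \<open>The increasing list of chosen indices is a subsequence of the list of all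
    positions; mapping \<open>nth\<close> over both yields the claim.\<close>
  have "sorted_wrt (<) (map i [0..<length \<tau>])"
    using i(1) by (auto simp: sorted_wrt_iff_nth_less strict_mono_on_def)
  then have "subseq (map i [0..<length \<tau>]) [0..<length \<pi>]"
    using i(2) by (intro sorted_subset_imp_subseq) (fastforce simp: strict_sorted_iff)+
  then have "subseq (map ((!) \<pi>) (map i [0..<length \<tau>])) (map ((!) \<pi>) [0..<length \<pi>])"
    by (rule subseq_map)
  also have "map ((!) \<pi>) (map i [0..<length \<tau>]) = \<tau>" by (subst (2) i(3)) simp
  also have "map ((!) \<pi>) [0..<length \<pi>] = \<pi>" by (rule map_nth)
  finally show "subseq \<tau> \<pi>" .
qed

text \<open>An occurrence is replaced by the word of its letters, so that indices disappear.
  Exchanging \<open>a\<close> and \<open>b\<close> turns one comparison into the other, so a single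
  equivalence records the whole order type.\<close>

lemma contains_pattern_iff_subseq:
  "contains_pattern \<pi> \<rho> \<longleftrightarrow> (\<exists>\<tau>. length \<tau> = length \<rho> \<and> subseq \<tau> \<pi> \<and>
     (\<forall>a<length \<rho>. \<forall>b<length \<rho>. \<tau> ! a < \<tau> ! b \<longleftrightarrow> \<rho> ! a < \<rho> ! b))" (is "?l = ?r")
proof
  assume ?l
  then obtain i where i: "strict_mono_on {..<length \<rho>} i" "i ` {..<length \<rho>} \<subseteq> {..<length \<pi>}"
    "\<forall>a<length \<rho>. \<forall>b<length \<rho>. \<pi> ! i a < \<pi> ! i b \<longleftrightarrow> \<rho> ! a < \<rho> ! b"
    unfolding contains_pattern_def by blast
  show ?r
    using i by (intro exI[of _ "map (\<lambda>a. \<pi> ! i a) [0..<length \<rho>]"]) (auto simp: subseq_iff_index)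
next
  assume ?r
  then obtain \<tau> i where *: "length \<tau> = length \<rho>"
    "\<forall>a<length \<rho>. \<forall>b<length \<rho>. \<tau> ! a < \<tau> ! b \<longleftrightarrow> \<rho> ! a < \<rho> ! b"
    "strict_mono_on {..<length \<rho>} i" "i ` {..<length \<rho>} \<subseteq> {..<length \<pi>}"
    "\<tau> = map (\<lambda>a. \<pi> ! i a) [0..<length \<rho>]"
    unfolding subseq_iff_index by metis
  have "\<tau> ! a = \<pi> ! i a" if "a < length \<rho>" for a
    using *(5) that by simp
  with * show ?l
    unfolding contains_pattern_def by (intro exI[of _ i]) simp
qed

section \<open>The four patterns as explicit subsequences\<close>

lemma ex_list_length_Suc:
  "(\<exists>xs. length xs = Suc n \<and> P xs) \<longleftrightarrow> (\<exists>x xs. length xs = n \<and> P (x # xs))"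
  by (metis length_Suc_conv length_Cons)

lemma contains_121:
  "contains_pattern w [1,2,1] \<longleftrightarrow> (\<exists>x y. x < y \<and> subseq [x,y,x] w)"
  by (simp add: contains_pattern_iff_subseq ex_list_length_Suc All_less_Suc2 numeral_eq_Suc)
     (metis linorder_less_linear less_asym)

lemma contains_112:
  "contains_pattern w [1,1,2] \<longleftrightarrow> (\<exists>x y. x < y \<and> subseq [x,x,y] w)"
  by (simp add: contains_pattern_iff_subseq ex_list_length_Suc All_less_Suc2 numeral_eq_Suc)
     (metis linorder_less_linear less_asym)

lemma contains_1233:
  "contains_pattern w [1,2,3,3] \<longleftrightarrow> (\<exists>x y z. x < y \<and> y < z \<and> subseq [x,y,z,z] w)"
proof
  assume "contains_pattern w [1,2,3,3]"
  \<comment> \<open>Equal letters of the pattern yield only two negated comparisons; linearity of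
    the order turns them into \<open>u = z\<close>.\<close>
  then obtain x y z u where "subseq [x,y,z,u] w" "x < y" "y < z" "\<not> z < u" "\<not> u < z"
    by (auto simp: contains_pattern_iff_subseq ex_list_length_Suc All_less_Suc2 numeral_eq_Suc)
  moreover from this have "u = z" by simp
  ultimately show "\<exists>x y z. x < y \<and> y < z \<and> subseq [x,y,z,z] w" by blast
next
  assume "\<exists>x y z. x < y \<and> y < z \<and> subseq [x,y,z,z] w"
  then obtain x y z where *: "x < y" "y < z" "subseq [x,y,z,z] w" by blast
  then show "contains_pattern w [1,2,3,3]"
    unfolding contains_pattern_iff_subseq
    by (intro exI[of _ "[x,y,z,z]"]) (auto simp: All_less_Suc2 numeral_eq_Suc)
qed

lemma contains_2133:
  "contains_pattern w [2,1,3,3] \<longleftrightarrow> (\<exists>x y z. x < y \<and> y < z \<and> subseq [y,x,z,z] w)"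
proof
  assume "contains_pattern w [2,1,3,3]"
  then obtain x y z u where "subseq [y,x,z,u] w" "x < y" "y < z" "\<not> z < u" "\<not> u < z"
    by (auto simp: contains_pattern_iff_subseq ex_list_length_Suc All_less_Suc2 numeral_eq_Suc)
  moreover from this have "u = z" by simp
  ultimately show "\<exists>x y z. x < y \<and> y < z \<and> subseq [y,x,z,z] w" by blast
next
  assume "\<exists>x y z. x < y \<and> y < z \<and> subseq [y,x,z,z] w"
  then obtain x y z where *: "x < y" "y < z" "subseq [y,x,z,z] w" by blast
  then show "contains_pattern w [2,1,3,3]"
    unfolding contains_pattern_iff_subseq
    by (intro exI[of _ "[y,x,z,z]"]) (auto simp: All_less_Suc2 numeral_eq_Suc)
qed

section \<open>Matching subsequences across a prefix or suffix\<close>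

lemma set_subseq: "subseq l w \<Longrightarrow> set l \<subseteq> set w"
  by (induction rule: list_emb.induct) auto

lemma subseq_filter_iff:
  assumes "\<And>x. x \<in> set l \<Longrightarrow> P x"
  shows "subseq l (filter P w) \<longleftrightarrow> subseq l w"
proof
  assume "subseq l w"
  then have "subseq (filter P l) (filter P w)" by (rule subseq_filter)
  moreover have "filter P l = l" using assms by (simp add: filter_id_conv)
  ultimately show "subseq l (filter P w)" by simp
qed (rule subseq_order.order_trans[OF _ subseq_filter_left])

lemma subseq_strip_left:
  "x \<notin> set ys \<Longrightarrow> subseq (x # l) (ys @ u) \<longleftrightarrow> subseq (x # l) u"
  by (induction ys) auto

text \<open>Matching the leading letter at its first occurrence leaves the longest remainder for
  \<open>l\<close>.\<close>

lemma subseq_Cons_first: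
  "x \<notin> set ys \<Longrightarrow> subseq (x # l) (ys @ x # u) \<longleftrightarrow> subseq l u"
  by (simp add: subseq_strip_left)

lemma subseq_strip_right:
  assumes "x \<notin> set zs"
  shows "subseq (l @ [x]) (u @ zs) \<longleftrightarrow> subseq (l @ [x]) u"
  using assms
proof (induction zs rule: rev_induct)
  case (snoc z zs)
  have "subseq (l @ [x]) (v @ [z]) \<longleftrightarrow> subseq (l @ [x]) v" if "x \<noteq> z" for v
  proof
    assume "subseq (l @ [x]) (v @ [z])"
    then obtain l1 l2 where l: "l @ [x] = l1 @ l2" "subseq l1 v" "subseq l2 [z]"
      by (rule subseq_appendE)
    show "subseq (l @ [x]) v"
    proof (cases l2 rule: rev_cases)
      case Nil
      then show ?thesis using l by simp
    next
      case (snoc l' y)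
      then have "y \<in> set [z]"
        using set_subseq[OF l(3)] by auto
      then show ?thesis using snoc l(1) that by simp
    qed
  qed (simp add: subseq_rev_drop_many)
  from this[of "u @ zs"] snoc show ?case by simp
qed simp

text \<open>The letter \<open>x\<close> must be matched in the front block: no \<open>z\<close>
  follows the trailing copies, and neither \<open>ys\<close> nor \<open>zs\<close> holds an
  \<open>x\<close>. Then \<open>y\<close> falls into \<open>ys\<close> and both letters
  \<open>z\<close> into \<open>zs\<close>.\<close>

lemma subseq_21zz_insert_block:
  assumes "x \<notin> set ys" "x \<notin> set zs" "y \<noteq> x" "z \<noteq> x" "0 < b"
  shows "subseq [y,x,z,z] (ys @ replicate b x @ zs @ replicate e x) \<longleftrightarrow> y \<in> set ys \<and> subseq [z,z] zs"
proof
  have x: "x \<notin> set l" if "subseq l zs" for l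
    using that assms(2) set_subseq by blast
  \<comment> \<open>Here \<open>z\<close> would have to lie in \<open>ys\<close>, with an
    \<open>x\<close> in front of it.\<close>
  have yxz: "\<not> subseq ([y,x,z] @ l) (ys @ replicate b x)" for l
  proof
    assume "subseq ([y,x,z] @ l) (ys @ replicate b x)"
    moreover have "subseq ([y,x] @ [z]) ([y,x,z] @ l)" by simp
    ultimately have "subseq ([y,x] @ [z]) (ys @ replicate b x)"
      by (rule subseq_order.order_trans[rotated])
    then have "subseq ([y,x] @ [z]) ys"
      using assms(4) by (subst (asm) subseq_strip_right) auto
    then show False using assms(1) by (auto dest!: set_subseq)
  qed
  assume "subseq [y,x,z,z] (ys @ replicate b x @ zs @ replicate e x)"
  then have "subseq ([y,x,z] @ [z]) ((ys @ replicate b x @ zs) @ replicate e x)" by simp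
  then have "subseq ([y,x,z] @ [z]) ((ys @ replicate b x) @ zs)"
    using assms(4) by (subst (asm) subseq_strip_right) auto
  then obtain l1 l2 where l: "[y,x,z] @ [z] = l1 @ l2" "subseq l1 (ys @ replicate b x)" "subseq l2 zs"
    by (rule subseq_appendE)
  \<comment> \<open>\<open>zs\<close> contains no \<open>x\<close>, so the cut comes after
    \<open>x\<close>; by \<open>yxz\<close> it comes before the first \<open>z\<close>.\<close>
  have "l1 = [y,x] \<and> l2 = [z,z]"
    using l(1) x[OF l(3)] yxz[of "[]"] yxz[of "[z]"] l(2)
    by (auto simp: Cons_eq_append_conv)
  then have "y \<in> set ys" "subseq [z,z] zs"
    using l(2,3) assms(3) by (auto dest!: set_subseq)
  then show "y \<in> set ys \<and> subseq [z,z] zs" by blast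
next
  assume *: "y \<in> set ys \<and> subseq [z,z] zs"
  have "subseq ([y] @ [x] @ [z,z] @ []) (ys @ replicate b x @ zs @ replicate e x)"
    using * assms(5) by (intro list_emb_append_mono) (auto simp: subseq_singleton_left)
  then show "subseq [y,x,z,z] (ys @ replicate b x @ zs @ replicate e x)" by simp
qed

subsection \<open>Inserting copies of a new smallest letter\<close>

text \<open>One shape serves both short patterns: 121 takes \<open>e = 0\<close>, and 112 takes
  \<open>b = 1\<close> with all further copies at the end.\<close>

definition insert_block :: "nat \<Rightarrow> nat \<Rightarrow> 'a \<Rightarrow> nat \<Rightarrow> 'a list \<Rightarrow> 'a list" where
  "insert_block b e x p w = take p w @ replicate b x @ drop p w @ replicate e x"

definition dsites :: "'a list \<Rightarrow> nat set" where
  "dsites w = {p. p \<le> length w \<and> distinct (drop p w)}"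

definition sites1233 :: "nat list \<Rightarrow> nat set" where
  "sites1233 w = {p. p \<le> length w \<and> \<not> (\<exists>y c. y < c \<and> subseq [y,c,c] (drop p w))}"

definition sites2133 :: "nat list \<Rightarrow> nat set" where
  "sites2133 w = {p. p \<le> length w \<and> \<not> (\<exists>y c. y < c \<and> y \<in> set (take p w) \<and> subseq [c,c] (drop p w))}"

text \<open>Position of \<open>w\<close> that corresponds to position \<open>q\<close> of \<open>insert_block b e x p w\<close>; it exceeds the
  length of \<open>w\<close> when \<open>q\<close> lies inside the trailing block.\<close>

definition old_site :: "nat \<Rightarrow> nat \<Rightarrow> nat \<Rightarrow> nat" where
  "old_site b p q = min q p + (q - (p + b))"

lemma subseq_Cons_in_set: "subseq (y # l) w \<Longrightarrow> y \<in> set w"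
  using set_subseq by fastforce

lemma distinct_iff_not_subseq: "distinct w \<longleftrightarrow> (\<forall>c. \<not> subseq [c,c] w)"
proof (induction w)
  case (Cons a w)
  have "subseq [c,c] (a # w) \<longleftrightarrow> c = a \<and> a \<in> set w \<or> subseq [c,c] w" for c
    using subseq_Cons_in_set[of c "[c]" w] by (auto simp add: subseq_singleton_left)
  then have "(\<forall>c. \<not> subseq [c,c] (a # w)) \<longleftrightarrow> a \<notin> set w \<and> (\<forall>c. \<not> subseq [c,c] w)"
    by blast
  then show ?case unfolding distinct.simps Cons.IH by (rule sym)
qed simp

lemma length_insert_block [simp]: "length (insert_block b e x p w) = length w + b + e"
  by (simp add: insert_block_def)

lemma mset_insert_block: "mset (insert_block b e x p w) = replicate_mset (b + e) x + mset w"
proof (rule multiset_eqI)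
  fix y
  have "count (mset (take p w) + mset (drop p w)) y = count (mset w) y"
    by (metis append_take_drop_id mset_append)
  then show "count (mset (insert_block b e x p w)) y = count (replicate_mset (b + e) x + mset w) y"
    by (auto simp: insert_block_def)
qed

section \<open>Patterns and admissible positions after inserting a new minimum\<close>

context
  fixes x :: nat and w :: "nat list" and b e p :: nat
  assumes min: "\<forall>y\<in>set w. x < y" and b: "0 < b" and p: "p \<le> length w"
begin

lemma new_letter: "x \<notin> set w" "x \<notin> set (take k w)" "x \<notin> set (drop k w)"
  using min by (auto dest: in_set_takeD in_set_dropD)

lemma filter_old: "filter (\<lambda>y. y \<noteq> x) (take k w) = take k w" 
   "filter (\<lambda>y. y \<noteq> x) (drop k w) = drop k w" "filter (\<lambda>y. y \<noteq> x) (drop k (take m w)) = drop k (take m w)"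
   "filter (\<lambda>y. y \<noteq> x) (take k (drop m w)) = take k (drop m w)"
  using new_letter by (auto simp: filter_id_conv dest: in_set_takeD in_set_dropD)

lemma filter_new: "filter (\<lambda>y. y = x) (drop k w) = []" "filter (\<lambda>y. y = x) (drop k (take m w)) = []"
  using new_letter by (auto simp: filter_empty_conv dest: in_set_takeD in_set_dropD)

text \<open>Questions about old letters in a suffix of the new word thereby become questions about a
  suffix of \<open>w\<close>.\<close>

lemma filter_drop_insert_block:
  "filter (\<lambda>y. y \<noteq> x) (drop q (insert_block b e x p w)) = drop (old_site b p q) w"
proof (cases "q \<le> p")
  case True
  then have "drop q (take p w) @ drop p w = drop q w"
    by (metis append_take_drop_id drop_append diff_is_0_eq drop_0 length_take min.absorb2 p)
  with True show ?thesis using p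
    by (simp add: insert_block_def filter_old old_site_def)
next
  case False
  then show ?thesis using p
    by (simp add: insert_block_def filter_old old_site_def ac_simps)
qed

lemma filter_take_insert_block:
  "filter (\<lambda>y. y \<noteq> x) (take q (insert_block b e x p w)) = take (old_site b p q) w"
proof (cases "q \<le> p")
  case True
  with p show ?thesis
    by (simp add: insert_block_def filter_old old_site_def)
next
  case False
  then show ?thesis using p
    by (simp add: insert_block_def filter_old old_site_def take_add)
qed

lemma subseq_drop_insert_block:
  "x \<notin> set l \<Longrightarrow> subseq l (drop q (insert_block b e x p w)) \<longleftrightarrow> subseq l (drop (old_site b p q) w)"
  by (subst filter_drop_insert_block[symmetric], subst subseq_filter_iff) auto

lemma subseq_insert_block:
  "x \<notin> set l \<Longrightarrow> subseq l (insert_block b e x p w) \<longleftrightarrow> subseq l w"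
  using subseq_drop_insert_block[of l 0] by (simp add: old_site_def)

lemma set_insert_block: "set (insert_block b e x p w) = insert x (set w)"
proof -
  have "set_mset (mset (insert_block b e x p w)) = insert x (set w)"
    unfolding mset_insert_block using b by simp
  then show ?thesis by simp
qed

lemma ge_new: "y \<in> set (insert_block b e x p w) \<Longrightarrow> x \<le> y"
  using min by (auto simp: set_insert_block intro: less_imp_le)

lemma ge_new_subseq: "subseq (y # l) (drop q (insert_block b e x p w)) \<Longrightarrow> y = x \<or> x < y"
  using ge_new by (fastforce dest!: subseq_Cons_in_set in_set_dropD)

lemma gt_old_subseq: "subseq (y # l) (drop q w) \<Longrightarrow> x < y"
  using min by (auto dest!: subseq_Cons_in_set in_set_dropD)

lemma new_in_take_insert_block: "x \<in> set (take q (insert_block b e x p w)) \<longleftrightarrow> p < q"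
  using p b new_letter by (auto simp: insert_block_def dest: in_set_takeD)

text \<open>A new occurrence uses \<open>x\<close>, which as the smallest letter can only play the
  1. Its first copy, at position \<open>p\<close>, is the best choice, so \<open>y z z\<close> must
  follow there; the other copies of \<open>x\<close> are filtered away.\<close>

lemma contains_1233_insert_block:
  "contains_pattern (insert_block b e x p w) [1,2,3,3] \<longleftrightarrow>
    contains_pattern w [1,2,3,3] \<or> p \<notin> sites1233 w"
proof -
  have b': "replicate b x = x # replicate (b - 1) x" using b by (cases b) auto
  have *: "subseq [x,y,z,z] (insert_block b e x p w) \<longleftrightarrow> subseq [y,z,z] (drop p w)"
    if "x < y" "y < z" for y z
  proof -
    have "subseq [x,y,z,z] (insert_block b e x p w) \<longleftrightarrow>
       subseq [y,z,z] (replicate (b - 1) x @ drop p w @ replicate e x)"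
      unfolding insert_block_def b' append_Cons by (rule subseq_Cons_first) (rule new_letter)
    also have "\<dots> \<longleftrightarrow> subseq [y,z,z] (filter (\<lambda>y. y \<noteq> x) (replicate (b - 1) x @ drop p w @ replicate e x))"
      using that by (subst subseq_filter_iff) auto
    finally show ?thesis by (simp add: filter_old)
  qed
  have **: "subseq [y,z,u,u] (insert_block b e x p w) \<longleftrightarrow> subseq [y,z,u,u] w"
     if "x < y" "y < z" "z < u" for y z u
    using that by (intro subseq_insert_block) auto
  have "contains_pattern (insert_block b e x p w) [1,2,3,3] \<longleftrightarrow>
     (\<exists>y z. x < y \<and> y < z \<and> subseq [x,y,z,z] (insert_block b e x p w)) \<or>
     (\<exists>y z u. x < y \<and> y < z \<and> z < u \<and> subseq [y,z,u,u] (insert_block b e x p w))"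
    unfolding contains_1233 using ge_new_subseq[of _ _ 0] by (simp only: drop_0) blast
  also have "\<dots> \<longleftrightarrow> (\<exists>y z. x < y \<and> y < z \<and> subseq [y,z,z] (drop p w)) \<or>
     (\<exists>y z u. x < y \<and> y < z \<and> z < u \<and> subseq [y,z,u,u] w)"
    using * ** by blast
  also have "\<dots> \<longleftrightarrow> (\<exists>y z. y < z \<and> subseq [y,z,z] (drop p w)) \<or>
     (\<exists>y z u. y < z \<and> z < u \<and> subseq [y,z,u,u] w)"
    using gt_old_subseq[of _ _ p] gt_old_subseq[of _ _ 0] by (simp only: drop_0) blast
  finally show ?thesis using p unfolding contains_1233 sites1233_def mem_Collect_eq by blast
qed

text \<open>Again \<open>x\<close> can only play the 1; by \<open>subseq_21zz_insert_block\<close>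
  the letter \<open>y\<close> then lies before position \<open>p\<close> and \<open>z z\<close>
  behind it.\<close>

lemma contains_2133_insert_block:
  "contains_pattern (insert_block b e x p w) [2,1,3,3] \<longleftrightarrow>
    contains_pattern w [2,1,3,3] \<or> p \<notin> sites2133 w"
proof -
  have *: "subseq [y,x,z,z] (insert_block b e x p w) \<longleftrightarrow> y \<in> set (take p w) \<and> subseq [z,z] (drop p w)"
    if "x < y" "y < z" for y z
    unfolding insert_block_def using that b new_letter
    by (intro subseq_21zz_insert_block) auto
  have **: "subseq [z,y,u,u] (insert_block b e x p w) \<longleftrightarrow> subseq [z,y,u,u] w"
     if "x < y" "y < z" "z < u" for y z u
    using that by (intro subseq_insert_block) auto
  have "contains_pattern (insert_block b e x p w) [2,1,3,3] \<longleftrightarrow>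
     (\<exists>y z. x < y \<and> y < z \<and> subseq [y,x,z,z] (insert_block b e x p w)) \<or>
     (\<exists>y z u. x < y \<and> y < z \<and> z < u \<and> subseq [z,y,u,u] (insert_block b e x p w))"
    unfolding contains_2133 using ge_new_subseq[of _ _ 0, OF subseq_Cons', unfolded drop_0] by blast
  also have "\<dots> \<longleftrightarrow> (\<exists>y z. x < y \<and> y < z \<and> y \<in> set (take p w) \<and> subseq [z,z] (drop p w)) \<or>
     (\<exists>y z u. x < y \<and> y < z \<and> z < u \<and> subseq [z,y,u,u] w)"
    using * ** by blast
  also have "\<dots> \<longleftrightarrow> (\<exists>y z. y < z \<and> y \<in> set (take p w) \<and> subseq [z,z] (drop p w)) \<or>
     (\<exists>y z u. y < z \<and> z < u \<and> subseq [z,y,u,u] w)"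
    using gt_old_subseq[of _ _ 0, OF subseq_Cons', unfolded drop_0] min by (blast dest: in_set_takeD)
  finally show ?thesis using p unfolding contains_2133 sites2133_def mem_Collect_eq by blast
qed

text \<open>Up to \<open>p\<close> the prefix is old, so nothing changes. Beyond \<open>p\<close>
  the prefix contains \<open>x\<close>, which is below every old letter, so every repeated old
  letter in the suffix is an obstruction. Repeated copies of \<open>x\<close> never obstruct, since
  the repeated letter must exceed another one.\<close>

lemma sites2133_insert_block:
  "q \<in> sites2133 (insert_block b e x p w) \<longleftrightarrow> q \<le> length w + b + e \<and>
     (if q \<le> p then q \<in> sites2133 w else distinct (drop (old_site b p q) w))"
proof -
  let ?w = "insert_block b e x p w"
  have "(y < c \<and> y \<in> set (take q ?w) \<and> subseq [c,c] (drop q ?w)) \<longleftrightarrow>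
     y < c \<and> y \<in> set (take q ?w) \<and> subseq [c,c] (drop (old_site b p q) w)" for y c
    using subseq_drop_insert_block[of "[c,c]" q] ge_new[of y] by (auto dest: in_set_takeD)
  moreover have "y \<in> set (take q ?w) \<longleftrightarrow> y = x \<and> p < q \<or> y \<in> set (take (old_site b p q) w)" for y
    using filter_take_insert_block[of q] new_in_take_insert_block[of q] new_letter
    by (cases "y = x") (auto simp flip: filter_take_insert_block)
  ultimately have *: "q \<in> sites2133 ?w \<longleftrightarrow> q \<le> length w + b + e \<and>
     \<not> (\<exists>y c. y < c \<and> (y = x \<and> p < q \<or> y \<in> set (take (old_site b p q) w))
        \<and> subseq [c,c] (drop (old_site b p q) w))"
    by (simp add: sites2133_def) blast
  show ?thesis
  proof (cases "q \<le> p")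
    case True
    then have "old_site b p q = q" by (simp add: old_site_def)
    with True * p show ?thesis by (auto simp: sites2133_def)
  next
    case False
    then show ?thesis
      unfolding * distinct_iff_not_subseq using gt_old_subseq[of _ _ "old_site b p q"] by auto
  qed
qed

text \<open>The low letter of an obstruction \<open>y c c\<close> is old or a copy of
  \<open>x\<close>; only copies in the front block can have old letters behind them, whence the
  condition for \<open>q < p + b\<close>. The alternative
  \<open>length w \<le> old_site b p q\<close> covers the trailing block, where the old suffix is
  empty but the index may exceed the range allowed in \<open>sites1233 w\<close>.\<close>

lemma sites1233_insert_block:
  "q \<in> sites1233 (insert_block b e x p w) \<longleftrightarrow> q \<le> length w + b + e \<and>
     (old_site b p q \<in> sites1233 w \<or> length w \<le> old_site b p q) \<and> (q < p + b \<longrightarrow> distinct (drop p w))"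
proof -
  let ?w = "insert_block b e x p w"
  have len: "length (drop k w) = 0 \<Longrightarrow> subseq [y,c,c] (drop k w) \<longleftrightarrow> False" for y c k by simp
  have "subseq [x,c,c] (drop q ?w) \<longleftrightarrow> q < p + b \<and> subseq [c,c] (drop p w)" if "x < c" for c
  proof (cases "q < p + b")
    case True
    \<comment> \<open>At least one copy of the front block remains behind \<open>q\<close>;
      \<open>k\<close> counts the others.\<close>
    then obtain k where k: "b - (q - p) = Suc k"
      using b by (cases "b - (q - p)") auto
    have "drop q ?w = drop q (take p w) @ x # replicate k x @ drop p w @ replicate e x"
      using True p by (simp add: insert_block_def k)
    then have "subseq [x,c,c] (drop q ?w) \<longleftrightarrow> subseq [c,c] (replicate k x @ drop p w @ replicate e x)"
      using new_letter by (subst subseq_Cons_first[symmetric, of x "drop q (take p w)"]) (auto dest: in_set_dropD)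
    also have "\<dots> \<longleftrightarrow> subseq [c,c] (filter (\<lambda>y. y \<noteq> x) (replicate k x @ drop p w @ replicate e x))"
      using that by (subst subseq_filter_iff) auto
    finally show ?thesis using True by (simp add: filter_old)
  next
    case False
    then have "drop q ?w = drop (q - b) w @ drop (q - (length w + b)) (replicate e x)"
      using p by (simp add: insert_block_def)
    \<comment> \<open>\<open>c\<close> cannot be matched in the trailing block, and what is left of
      the suffix contains no \<open>x\<close>.\<close>
    then have "\<not> subseq ([x,c] @ [c]) (drop q ?w)"
      using that new_letter by (simp only:) (subst subseq_strip_right, auto dest!: set_subseq)
    with False show ?thesis by simp
  qed
  moreover have "subseq [y,c,c] (drop q ?w) \<longleftrightarrow> subseq [y,c,c] (drop (old_site b p q) w)"
    if "x < y" "y < c" for y c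
    using that by (intro subseq_drop_insert_block) auto
  moreover have "(\<exists>y c. y < c \<and> subseq [y,c,c] (drop q ?w)) \<longleftrightarrow>
     (\<exists>c. x < c \<and> subseq [x,c,c] (drop q ?w)) \<or> (\<exists>y c. x < y \<and> y < c \<and> subseq [y,c,c] (drop q ?w))"
    using ge_new_subseq by blast
  ultimately have *: "(\<exists>y c. y < c \<and> subseq [y,c,c] (drop q ?w)) \<longleftrightarrow>
     q < p + b \<and> (\<exists>c. x < c \<and> subseq [c,c] (drop p w)) \<or>
     (\<exists>y c. x < y \<and> y < c \<and> subseq [y,c,c] (drop (old_site b p q) w))"
    by blast
  have "(\<exists>y c. y < c \<and> subseq [y,c,c] (drop q ?w)) \<longleftrightarrow>
     q < p + b \<and> \<not> distinct (drop p w) \<or>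
     (\<exists>y c. y < c \<and> subseq [y,c,c] (drop (old_site b p q) w))"
    unfolding * distinct_iff_not_subseq using gt_old_subseq by blast
  then show ?thesis
    using len[of "old_site b p q"] by (auto simp: sites1233_def)
qed

text \<open>Old letters and copies of \<open>x\<close> are tested separately; the last sum counts
  the copies of \<open>x\<close> in the suffix, from the front block and from the trailing
  one.\<close>

lemma dsites_insert_block:
  "q \<in> dsites (insert_block b e x p w) \<longleftrightarrow> q \<le> length w + b + e \<and>
     distinct (drop (old_site b p q) w) \<and> (b - (q - p)) + (e - (q - (length w + b))) \<le> 1"
proof -
  let ?w = "insert_block b e x p w"
  have *: "drop q ?w = drop q (take p w) @ replicate (b - (q - p)) x @ drop (q - (p + b)) (drop p w)
      @ replicate (e - (q - (length w + b))) x"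
    using p by (simp add: insert_block_def)
  have "subseq [x,x] (drop q ?w) \<longleftrightarrow> subseq [x,x] (filter (\<lambda>y. y = x) (drop q ?w))"
    by (subst subseq_filter_iff) auto
  also have "filter (\<lambda>y. y = x) (drop q ?w) = replicate (b - (q - p) + (e - (q - (length w + b)))) x"
    unfolding * by (simp add: filter_new replicate_add)
  also have "subseq [x,x] (replicate m x) \<longleftrightarrow> 1 < m" for m
    by (cases m; cases "m - 1") (auto)
  finally have xx: "subseq [x,x] (drop q ?w) \<longleftrightarrow> 1 < b - (q - p) + (e - (q - (length w + b)))" .
  have "distinct (drop q ?w) \<longleftrightarrow> \<not> subseq [x,x] (drop q ?w) \<and> (\<forall>c. c \<noteq> x \<longrightarrow> \<not> subseq [c,c] (drop q ?w))"
    unfolding distinct_iff_not_subseq by metis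
  also have "(\<forall>c. c \<noteq> x \<longrightarrow> \<not> subseq [c,c] (drop q ?w)) \<longleftrightarrow> (\<forall>c. c \<noteq> x \<longrightarrow> \<not> subseq [c,c] (drop (old_site b p q) w))"
    by (simp add: subseq_drop_insert_block)
  also have "\<dots> \<longleftrightarrow> distinct (drop (old_site b p q) w)"
    unfolding distinct_iff_not_subseq using gt_old_subseq by (metis less_irrefl)
  finally show ?thesis unfolding xx by (auto simp: dsites_def)
qed

end

subsection \<open>The generating tree\<close>

lemma dsites_eq_atLeastAtMost:
  obtains t where "t \<le> length w" "\<And>q. distinct (drop q w) \<longleftrightarrow> t \<le> q" "dsites w = {t..length w}"
proof
  define t where "t = (LEAST q. distinct (drop q w))"
  have *: "distinct (drop (length w) w)" by simp
  show "t \<le> length w" unfolding t_def by (rule Least_le) simp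
  show iff: "distinct (drop q w) \<longleftrightarrow> t \<le> q" for q
  proof
    assume "t \<le> q"
    have "distinct (drop t w)" unfolding t_def using * by (rule LeastI)
    then have "distinct (drop (q - t) (drop t w))" by (rule distinct_drop)
    then show "distinct (drop q w)" using \<open>t \<le> q\<close> by simp
  qed (simp add: t_def Least_le)
  show "dsites w = {t..length w}" by (auto simp: dsites_def iff)
qed

lemma dsites_subset: "dsites w \<subseteq> sites1233 w" "dsites w \<subseteq> sites2133 w"
proof -
  have "\<not> subseq [c,c] (drop p w)" "\<not> subseq [y,c,c] (drop p w)" if "p \<in> dsites w" for p c y
    using that by (auto simp: dsites_def distinct_iff_not_subseq dest: subseq_Cons')
  then show "dsites w \<subseteq> sites1233 w" "dsites w \<subseteq> sites2133 w"
    by (auto simp: sites1233_def sites2133_def dsites_def)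
qed

text \<open>A later suffix is a subsequence of an earlier one. \<open>sites2133\<close> has no such
  closure in general, because prefixes grow as suffixes shrink.\<close>

lemma sites1233_mono:
  assumes "p \<in> sites1233 w" "p \<le> q" "q \<le> length w"
  shows "q \<in> sites1233 w"
proof -
  have "subseq l (drop p w)" if "subseq l (drop q w)" for l
    using that assms(2) by (metis subseq_order.order_trans suffix_imp_subseq suffix_drop drop_drop le_add_diff_inverse2)
  with assms show ?thesis by (auto simp: sites1233_def)
qed

text \<open>Here \<open>r\<close> is a suffix length in the new word, \<open>k\<close> the length of the old suffix behind the inserted block
  and \<open>v\<close> the old number of repetition-free suffixes: the two conjuncts say that the old letters,
  respectively the copies of the new letter, do not repeat among the last \<open>r\<close> letters.\<close>

definition dcount :: "nat \<Rightarrow> nat \<Rightarrow> nat \<Rightarrow> nat \<Rightarrow> nat" where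
  "dcount b e v k = card {r. min (r - e) k + (r - (k + b + e)) < v \<and> min r e + min (r - e - k) b \<le> 1}"

text \<open>If every repetition-free suffix of the old word is shorter than \<open>k\<close>, the
  bound on old letters takes effect before the front block is reached. The count then no longer
  depends on \<open>k\<close>, and \<open>k = v\<close> serves as representative.\<close>

lemma dcount_ge: "v \<le> k \<Longrightarrow> dcount b e v k = dcount b e v v"
proof -
  have "min (r - e) k + (r - (k + b + e)) < v \<and> min r e + min (r - e - k) b \<le> 1 \<longleftrightarrow>
      r - e < v \<and> min r e \<le> 1" if "v \<le> k" for k r
  proof (cases "r - e < v")
    case True
    with that have "min (r - e) k = r - e" "r - (k + b + e) = 0" "r - e - k = 0" by linarith+
    with True show ?thesis by simp
  next
    case False
    with that have "v \<le> min (r - e) k" by simp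
    with False show ?thesis by linarith
  qed
  moreover assume "v \<le> k"
  ultimately show ?thesis unfolding dcount_def by simp
qed

text \<open>Positions are read from the right: \<open>r = n + b + e - q\<close> is the length of the
  suffix at \<open>q\<close>. In these terms only the distance of \<open>p\<close> from the end of
  \<open>w\<close> enters the count.\<close>

lemma card_dsites_insert_block:
  fixes x :: nat
  assumes "\<forall>y\<in>set w. x < y" "0 < b" "p \<le> length w"
  shows "card (dsites (insert_block b e x p w)) = dcount b e (card (dsites w)) (length w - p)"
proof -
  obtain t where t: "t \<le> length w" "\<And>q. distinct (drop q w) \<longleftrightarrow> t \<le> q" "dsites w = {t..length w}"
    using dsites_eq_atLeastAtMost[of w] by blast
  define n where "n = length w"
  define D where "D = {r. min (r - e) (n - p) + (r - (n - p + b + e)) < Suc n - t \<and> min r e + min (r - e - (n - p)) b \<le> 1}"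
  have q: "q \<in> dsites (insert_block b e x p w) \<longleftrightarrow> q \<le> n + b + e \<and> t \<le> min q p + (q - (p + b)) \<and>
     (b - (q - p)) + (e - (q - (n + b))) \<le> 1" for q
    using dsites_insert_block[OF assms] t by (simp add: old_site_def n_def)
  \<comment> \<open>\<open>D\<close> states no bound on \<open>r\<close>; a longer suffix would
    count at least \<open>Suc n\<close> old letters, against the bound
    \<open>Suc n - t\<close>.\<close>
  have le: "r \<le> n + b + e" if "r \<in> D" for r
  proof (rule ccontr)
    assume "\<not> r \<le> n + b + e"
    moreover have p: "p \<le> n" using assms(3) by (simp add: n_def)
    ultimately have "n - p \<le> r - e" "Suc p \<le> r - (n - p + b + e)" by linarith+
    then have "Suc n \<le> min (r - e) (n - p) + (r - (n - p + b + e))" using p by linarith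
    moreover have "min (r - e) (n - p) + (r - (n - p + b + e)) < Suc n - t"
      using that unfolding D_def by blast
    ultimately show False by linarith
  qed
  have iff: "q \<in> dsites (insert_block b e x p w) \<longleftrightarrow> n + b + e - q \<in> D" if "q \<le> n + b + e" for q
  proof -
    have "t \<le> min q p + (q - (p + b)) \<longleftrightarrow>
      min (n + b + e - q - e) (n - p) + (n + b + e - q - (n - p + b + e)) < Suc n - t"
    proof -
      \<comment> \<open>The four ranges are the old prefix, the front block, the old suffix and the
        trailing block.\<close>
      consider "q \<le> p" | "p < q" "q \<le> p + b" | "p + b < q" "q \<le> n + b" | "n + b < q" by linarith
      then show ?thesis using that t(1) assms(3) by cases (auto simp: n_def)
    qed
    moreover have "b - (q - p) = min (n + b + e - q - e - (n - p)) b"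
      using that assms(3) by (auto simp: n_def)
    moreover have "e - (q - (n + b)) = min (n + b + e - q) e"
      using that by linarith
    ultimately show ?thesis using that by (simp add: q D_def ac_simps)
  qed
  have "bij_betw (\<lambda>q. n + b + e - q) (dsites (insert_block b e x p w)) D"
  proof (rule bij_betw_byWitness[where f' = "\<lambda>r. n + b + e - r"])
    show "(\<lambda>r. n + b + e - r) ` D \<subseteq> dsites (insert_block b e x p w)"
    proof (rule image_subsetI)
      fix r assume "r \<in> D"
      with le iff[of "n + b + e - r"] show "n + b + e - r \<in> dsites (insert_block b e x p w)"
        by simp
    qed
    show "(\<lambda>q. n + b + e - q) ` dsites (insert_block b e x p w) \<subseteq> D"
      using iff q by blast
  qed (use le q in simp_all)
  then have "card (dsites (insert_block b e x p w)) = card D"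
    by (rule bij_betw_same_card)
  then show ?thesis by (simp add: D_def dcount_def t n_def)
qed

text \<open>Among the sites outside \<open>dsites\<close>, those up to \<open>p\<close> survive an
  insertion at such a site \<open>p\<close> for 2133, so ranks count from below. The mirror image
  \<open>bij_betw_card_ge\<close> serves 1233, where those from \<open>p\<close> on survive.\<close>

lemma bij_betw_card_le:
  fixes X :: "nat set"
  assumes "finite X"
  shows "bij_betw (\<lambda>p. card {q \<in> X. q \<le> p}) X {1..card X}"
proof -
  have less: "card {q \<in> X. q \<le> p} < card {q \<in> X. q \<le> p'}" if "p < p'" "p' \<in> X" for p p'
  proof (rule psubset_card_mono)
    have "p' \<in> {q \<in> X. q \<le> p'} - {q \<in> X. q \<le> p}" using that by simp
    moreover have "{q \<in> X. q \<le> p} \<subseteq> {q \<in> X. q \<le> p'}" using that by auto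
    ultimately show "{q \<in> X. q \<le> p} \<subset> {q \<in> X. q \<le> p'}" by blast
  qed (use assms in simp)
  have inj: "inj_on (\<lambda>p. card {q \<in> X. q \<le> p}) X"
    by (rule linorder_inj_onI') (use less less_irrefl in \<open>metis (no_types, lifting)\<close>)
  have "card {q \<in> X. q \<le> p} \<in> {1..card X}" if "p \<in> X" for p
    using assms that by (auto intro!: card_mono simp: Suc_le_eq card_gt_0_iff)
  then have "(\<lambda>p. card {q \<in> X. q \<le> p}) ` X = {1..card X}"
    using assms card_image[OF inj] by (intro card_subset_eq) auto
  with inj show ?thesis by (simp add: bij_betw_def)
qed

lemma bij_betw_card_ge:
  fixes X :: "nat set"
  assumes "finite X"
  shows "bij_betw (\<lambda>p. card {q \<in> X. p \<le> q}) X {1..card X}"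
proof -
  have less: "card {q \<in> X. p' \<le> q} < card {q \<in> X. p \<le> q}" if "p < p'" "p \<in> X" for p p'
  proof (rule psubset_card_mono)
    have "p \<in> {q \<in> X. p \<le> q} - {q \<in> X. p' \<le> q}" using that by simp
    moreover have "{q \<in> X. p' \<le> q} \<subseteq> {q \<in> X. p \<le> q}" using that by auto
    ultimately show "{q \<in> X. p' \<le> q} \<subset> {q \<in> X. p \<le> q}" by blast
  qed (use assms in simp)
  have inj: "inj_on (\<lambda>p. card {q \<in> X. p \<le> q}) X"
    by (rule linorder_inj_onI') (use less less_irrefl in \<open>metis (no_types, lifting)\<close>)
  have "card {q \<in> X. p \<le> q} \<in> {1..card X}" if "p \<in> X" for p
    using assms that by (auto intro!: card_mono simp: Suc_le_eq card_gt_0_iff)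
  then have "(\<lambda>p. card {q \<in> X. p \<le> q}) ` X = {1..card X}"
    using assms card_image[OF inj] by (intro card_subset_eq) auto
  with inj show ?thesis by (simp add: bij_betw_def)
qed

text \<open>The summands account for the positions with, respectively without, repetition-free suffix.\<close>

definition child_stats :: "nat \<Rightarrow> nat \<Rightarrow> nat \<times> nat \<Rightarrow> (nat \<times> nat) multiset" where
  "child_stats b e = (\<lambda>(m, v).
     {#(m + b + e, dcount b e v k). k \<in># mset_set {..<v}#} +
     {#(i + v + e, dcount b e v v). i \<in># mset_set {1..m - v}#})"

text \<open>Collects what the two long patterns share. \<open>rank\<close> depends on
  \<open>w\<close> alone and takes each of its values once, so the multiset of child labels is fixed
  by the label of \<open>w\<close> and the block sizes, whichever position has which rank.\<close>

locale insertion_rule =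
  fixes \<rho> :: "nat list" and sites :: "nat list \<Rightarrow> nat set"
  assumes pattern_nonempty: "\<rho> \<noteq> []"
    and sites_le: "sites w \<subseteq> {..length w}"
    and dsites_le: "dsites w \<subseteq> sites w"
    and contains_insert_block:
      "\<lbrakk>\<forall>y\<in>set w. x < y; 0 < b; p \<le> length w\<rbrakk> \<Longrightarrow>
       contains_pattern (insert_block b e x p w) \<rho> \<longleftrightarrow> contains_pattern w \<rho> \<or> p \<notin> sites w"
    and card_sites_dsites:
      "\<lbrakk>\<forall>y\<in>set w. x < y; 0 < b; p \<in> dsites w\<rbrakk> \<Longrightarrow>
       card (sites (insert_block b e x p w)) = card (sites w) + b + e"
    and card_sites_rank:
      "\<exists>rank. bij_betw rank (sites w - dsites w) {1..card (sites w - dsites w)} \<and>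
        (\<forall>x b e. \<forall>p\<in>sites w - dsites w. (\<forall>y\<in>set w. x < y) \<longrightarrow> 0 < b \<longrightarrow>
           card (sites (insert_block b e x p w)) = rank p + card (dsites w) + e)"
begin

definition stat :: "nat list \<Rightarrow> nat \<times> nat" where
  "stat w = (card (sites w), card (dsites w))"

lemma stat_children:
  assumes min: "\<forall>y\<in>set w. x < y" and b: "0 < b"
  shows "{#stat (insert_block b e x p w). p \<in># mset_set (sites w)#} = child_stats b e (stat w)"
proof -
  obtain t where t: "t \<le> length w" "\<And>q. distinct (drop q w) \<longleftrightarrow> t \<le> q" "dsites w = {t..length w}"
    using dsites_eq_atLeastAtMost[of w] by blast
  obtain rank where rank: "bij_betw rank (sites w - dsites w) {1..card (sites w - dsites w)}"
    "\<And>p e. p \<in> sites w - dsites w \<Longrightarrow>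
       card (sites (insert_block b e x p w)) = rank p + card (dsites w) + e"
    using card_sites_rank[of w] min b by blast
  let ?v = "card (dsites w)" and ?m = "card (sites w)"
  have fin: "finite (sites w)" "finite (dsites w)"
    using finite_subset[OF sites_le[of w]] by (simp_all add: t)
  have v: "?v = Suc (length w) - t" by (simp add: t)
  have "stat (insert_block b e x p w) = (?m + b + e, dcount b e ?v (length w - p))" if "p \<in> dsites w" for p
    using that card_sites_dsites[OF min b that] card_dsites_insert_block[OF min b, of p]
    by (simp add: stat_def dsites_def)
  then have "{#stat (insert_block b e x p w). p \<in># mset_set (dsites w)#} =
     {#(?m + b + e, dcount b e ?v (length w - p)). p \<in># mset_set (dsites w)#}"
    using fin by (intro image_mset_cong) auto
  also have "\<dots> = image_mset (\<lambda>k. (?m + b + e, dcount b e ?v k)) (image_mset (\<lambda>p. length w - p) (mset_set (dsites w)))"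
    by (simp add: image_mset.compositionality comp_def)
  also have "image_mset (\<lambda>p. length w - p) (mset_set (dsites w)) = mset_set ((\<lambda>p. length w - p) ` dsites w)"
    by (rule image_mset_mset_set) (auto simp: inj_on_def t)
  also have "(\<lambda>p. length w - p) ` dsites w = {..<?v}"
  proof (intro equalityI subsetI)
    fix k assume "k \<in> {..<?v}"
    then show "k \<in> (\<lambda>p. length w - p) ` dsites w"
      using t(1) by (intro image_eqI[of _ _ "length w - k"]) (auto simp: t(3))
  qed (use t(1) in \<open>auto simp: t(3)\<close>)
  finally have D: "{#stat (insert_block b e x p w). p \<in># mset_set (dsites w)#} =
     {#(?m + b + e, dcount b e ?v k). k \<in># mset_set {..<?v}#}" .
  have "stat (insert_block b e x p w) = (rank p + ?v + e, dcount b e ?v ?v)" if "p \<in> sites w - dsites w" for p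
  proof -
    have "p \<le> length w" using that sites_le by auto
    \<comment> \<open>\<open>p\<close> lies before the threshold \<open>t\<close>, so no
      repetition-free suffix of \<open>w\<close> reaches back to the inserted block, and
      \<open>dcount_ge\<close> applies.\<close>
    moreover have "?v \<le> length w - p" using that \<open>p \<le> length w\<close> t(1) unfolding v by (auto simp: t(3))
    ultimately show ?thesis
      using rank(2)[OF that] card_dsites_insert_block[OF min b, of p] dcount_ge[of ?v "length w - p"]
      by (simp add: stat_def)
  qed
  then have "{#stat (insert_block b e x p w). p \<in># mset_set (sites w - dsites w)#} =
     {#(rank p + ?v + e, dcount b e ?v ?v). p \<in># mset_set (sites w - dsites w)#}"
    using fin by (intro image_mset_cong) auto
  also have "\<dots> = image_mset (\<lambda>i. (i + ?v + e, dcount b e ?v ?v)) (image_mset rank (mset_set (sites w - dsites w)))"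
    by (simp add: image_mset.compositionality comp_def)
  also have "image_mset rank (mset_set (sites w - dsites w)) = mset_set {1..?m - ?v}"
    using rank(1) fin dsites_le card_Diff_subset[of "dsites w" "sites w"]
    by (subst image_mset_mset_set) (auto simp: bij_betw_def)
  finally have R: "{#stat (insert_block b e x p w). p \<in># mset_set (sites w - dsites w)#} =
     {#(i + ?v + e, dcount b e ?v ?v). i \<in># mset_set {1..?m - ?v}#}" .
  have "mset_set (sites w) = mset_set (dsites w \<union> (sites w - dsites w))"
    using dsites_le by (simp add: Un_absorb1)
  also have "\<dots> = mset_set (dsites w) + mset_set (sites w - dsites w)"
    using fin by (intro mset_set_Union) auto
  finally have "mset_set (sites w) = mset_set (dsites w) + mset_set (sites w - dsites w)" .
  then show ?thesis
    by (simp only: image_mset_union D R) (simp only: child_stats_def stat_def prod.case)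
qed

end

section \<open>Both long patterns obey the insertion rule\<close>

interpretation rule1233: insertion_rule "[1,2,3,3]" sites1233
proof (unfold_locales, goal_cases)
  case 2
  then show ?case by (auto simp: sites1233_def)
next
  case 3
  then show ?case by (rule dsites_subset)
next
  case 4
  then show ?case by (rule contains_1233_insert_block)
next
  case (5 w x b p e)
  let ?n = "length w"
  have p: "p \<le> ?n" and D: "distinct (drop p w)" using 5 by (auto simp: dsites_def)
  have up: "q \<in> sites1233 w" if "p \<le> q" "q \<le> ?n" for q
    using that 5(3) dsites_subset sites1233_mono by blast
  have le: "q \<le> ?n" if "q \<in> sites1233 w" for q
    using that by (simp add: sites1233_def)
  \<comment> \<open>Positions up to \<open>p\<close> keep their status and all later ones are
    admissible before and after the insertion, so the sets differ only by the \<open>b + e\<close>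
    new positions at the end.\<close>
  have "sites1233 (insert_block b e x p w) = sites1233 w \<union> {?n<..?n + b + e}"
  proof (rule set_eqI)
    fix q
    show "q \<in> sites1233 (insert_block b e x p w) \<longleftrightarrow> q \<in> sites1233 w \<union> {?n<..?n + b + e}"
    proof (cases "q \<le> p")
      case True
      then show ?thesis using sites1233_insert_block[OF 5(1,2) p, where q = q and e = e] D p le up[of q]
        by (auto simp: old_site_def)
    next
      case False
      then have "p \<le> old_site b p q" by (simp add: old_site_def)
      then show ?thesis using False sites1233_insert_block[OF 5(1,2) p, where q = q and e = e] D up[of "old_site b p q"] up[of q] le[of q]
        by (cases "q \<le> ?n") auto
    qed
  qed
  moreover have "card (sites1233 w \<union> {?n<..?n + b + e}) = card (sites1233 w) + card {?n<..?n + b + e}"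
    using le by (intro card_Un_disjoint) (force simp: sites1233_def)+
  ultimately show ?case by simp
next
  case (6 w)
  let ?n = "length w" and ?X = "sites1233 w - dsites w"
  have fin: "finite (sites1233 w)" by (simp add: sites1233_def)
  have "card (sites1233 (insert_block b e x p w)) = card {q \<in> ?X. p \<le> q} + card (dsites w) + e"
    if p: "p \<in> ?X" and min: "\<forall>y\<in>set w. x < y" and b: "0 < b" for x b e p
  proof -
    have pn: "p \<le> ?n" and nd: "\<not> distinct (drop p w)" using p by (auto simp: sites1233_def dsites_def)
    obtain t where t: "t \<le> ?n" "\<And>q. distinct (drop q w) \<longleftrightarrow> t \<le> q" "dsites w = {t..?n}"
      using dsites_eq_atLeastAtMost[of w] by blast
    \<comment> \<open>Every position before \<open>p + b\<close> sees a copy of \<open>x\<close>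
      followed by a repeated larger letter; from \<open>p + b\<close> on, upward closure makes all
      positions admissible.\<close>
    have "sites1233 (insert_block b e x p w) = {p + b..?n + b + e}"
    proof (rule set_eqI)
      fix q
      have "old_site b p q \<in> sites1233 w \<or> ?n \<le> old_site b p q" if "p + b \<le> q"
        using that p sites1233_mono[of p w "old_site b p q"] by (auto simp: old_site_def)
      then show "q \<in> sites1233 (insert_block b e x p w) \<longleftrightarrow> q \<in> {p + b..?n + b + e}"
        using sites1233_insert_block[OF min b pn, where q = q and e = e] nd by auto
    qed
    \<comment> \<open>By upward closure the old sites from \<open>p\<close> on form an interval; the
      new interval is longer by \<open>e\<close>.\<close>
    moreover have "{q \<in> ?X. p \<le> q} \<union> dsites w = {p..?n}"
      using p sites1233_mono[of p w] dsites_subset(1)[of w] nd t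
      by (auto simp: sites1233_def)
    then have "card {q \<in> ?X. p \<le> q} + card (dsites w) = card {p..?n}"
      using fin by (subst card_Un_disjoint[symmetric]) (auto simp: dsites_def)
    ultimately show ?thesis using pn by simp
  qed
  then show ?case
    using bij_betw_card_ge[of ?X] fin by (intro exI[of _ "\<lambda>p. card {q \<in> ?X. p \<le> q}"]) auto
qed simp

interpretation rule2133: insertion_rule "[2,1,3,3]" sites2133
proof (unfold_locales, goal_cases)
  case 2
  then show ?case by (auto simp: sites2133_def)
next
  case 3
  then show ?case by (rule dsites_subset)
next
  case 4
  then show ?case by (rule contains_2133_insert_block)
next
  case (5 w x b p e)
  let ?n = "length w"
  have p: "p \<le> ?n" using 5 by (auto simp: dsites_def)
  obtain t where t: "t \<le> ?n" "\<And>q. distinct (drop q w) \<longleftrightarrow> t \<le> q" "dsites w = {t..?n}"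
    using dsites_eq_atLeastAtMost[of w] by blast
  have D: "t \<le> p" using 5 t by auto
  have up: "q \<in> sites2133 w" if "p \<le> q" "q \<le> ?n" for q
    using that D t dsites_subset(2)[of w] by auto
  have le: "q \<le> ?n" if "q \<in> sites2133 w" for q
    using that by (simp add: sites2133_def)
  \<comment> \<open>Again only the end grows: as \<open>t \<le> p\<close>, the old letters behind
    any later position do not repeat.\<close>
  have "sites2133 (insert_block b e x p w) = sites2133 w \<union> {?n<..?n + b + e}"
  proof (rule set_eqI)
    fix q
    show "q \<in> sites2133 (insert_block b e x p w) \<longleftrightarrow> q \<in> sites2133 w \<union> {?n<..?n + b + e}"
    proof (cases "q \<le> p")
      case True
      then show ?thesis using sites2133_insert_block[OF 5(1,2) p, where q = q and e = e] p by auto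
    next
      case False
      then have "t \<le> old_site b p q" using D by (simp add: old_site_def)
      then show ?thesis using False sites2133_insert_block[OF 5(1,2) p, where q = q and e = e] t(1,2) up[of q] le[of q]
        by (cases "q \<le> ?n") auto
    qed
  qed
  moreover have "card (sites2133 w \<union> {?n<..?n + b + e}) = card (sites2133 w) + card {?n<..?n + b + e}"
    using le by (intro card_Un_disjoint) (force simp: sites2133_def)+
  ultimately show ?case by simp
next
  case (6 w)
  let ?n = "length w" and ?X = "sites2133 w - dsites w"
  have fin: "finite (sites2133 w)" by (simp add: sites2133_def)
  have "card (sites2133 (insert_block b e x p w)) = card {q \<in> ?X. q \<le> p} + card (dsites w) + e"
    if p: "p \<in> ?X" and min: "\<forall>y\<in>set w. x < y" and b: "0 < b" for x b e p
  proof -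
    obtain t where t: "t \<le> ?n" "\<And>q. distinct (drop q w) \<longleftrightarrow> t \<le> q" "dsites w = {t..?n}"
      using dsites_eq_atLeastAtMost[of w] by blast
    have pn: "p \<le> ?n" and nd: "p < t" using p t by (auto simp: sites2133_def)
    \<comment> \<open>Up to \<open>p\<close> the old sites remain, and all of these precede
      \<open>t\<close>. Beyond \<open>p\<close> the old suffix must be repetition-free, and the
      threshold \<open>t\<close> is shifted by the block to \<open>t + b\<close>.\<close>
    have "sites2133 (insert_block b e x p w) = {q \<in> ?X. q \<le> p} \<union> {t + b..?n + b + e}"
    proof (rule set_eqI)
      fix q
      have "t \<le> old_site b p q \<longleftrightarrow> t + b \<le> q" if "p < q"
        using that nd by (simp add: old_site_def) linarith
      then show "q \<in> sites2133 (insert_block b e x p w) \<longleftrightarrow> q \<in> {q \<in> ?X. q \<le> p} \<union> {t + b..?n + b + e}"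
        using sites2133_insert_block[OF min b pn, where q = q and e = e] nd t by (cases "q \<le> p") auto
    qed
    moreover have "card ({q \<in> ?X. q \<le> p} \<union> {t + b..?n + b + e}) = card {q \<in> ?X. q \<le> p} + card {t + b..?n + b + e}"
      using fin nd by (intro card_Un_disjoint) auto
    ultimately show ?thesis using t(1,3) by simp
  qed
  then show ?case
    using bij_betw_card_le[of ?X] fin by (intro exI[of _ "\<lambda>p. card {q \<in> ?X. q \<le> p}"]) auto
qed simp

subsection \<open>Peeling off the smallest letter\<close>

lemma filter_insert_block:
  assumes "x \<notin> set w"
  shows "filter (\<lambda>y. y \<noteq> x) (insert_block b e x p w) = w"
proof -
  have "filter (\<lambda>y. y \<noteq> x) (take p w) = take p w" "filter (\<lambda>y. y \<noteq> x) (drop p w) = drop p w"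
    using assms by (auto simp: filter_id_conv dest: in_set_takeD in_set_dropD)
  then show ?thesis by (simp add: insert_block_def)
qed

text \<open>\<open>p\<close> is the position of the first \<open>x\<close>, and \<open>w\<close> is
  what remains after deleting \<open>x\<close>.\<close>

lemma insert_block_inject:
  assumes "x \<notin> set w" "x \<notin> set w'" "0 < b" "p \<le> length w" "p' \<le> length w'"
    and eq: "insert_block b e x p w = insert_block b e x p' w'"
  shows "w = w' \<and> p = p'"
proof -
  have "length (takeWhile (\<lambda>y. y \<noteq> x) (insert_block b e x q v)) = q"
    if "x \<notin> set v" "q \<le> length v" for q v
  proof -
    have "replicate b x = x # replicate (b - 1) x" using assms(3) by (cases b) auto
    then show ?thesis
      using that by (subst insert_block_def, subst takeWhile_append2) (auto dest: in_set_takeD)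
  qed
  then show ?thesis
    using assms filter_insert_block[of x w b e p] filter_insert_block[of x w' b e p'] by metis
qed

lemma image_mset_mset_set_Sigma:
  assumes "finite X" "\<And>w. w \<in> X \<Longrightarrow> finite (A w)"
  shows "image_mset f (mset_set (Sigma X A)) = (\<Sum>w\<in>X. {#f (w, p). p \<in># mset_set (A w)#})"
  using assms
proof (induction X rule: finite_induct)
  case (insert w X)
  have "Sigma (insert w X) A = Pair w ` A w \<union> Sigma X A" by auto
  also have "mset_set \<dots> = mset_set (Pair w ` A w) + mset_set (Sigma X A)"
    using insert by (intro mset_set_Union) auto
  also have "mset_set (Pair w ` A w) = image_mset (Pair w) (mset_set (A w))"
    by (rule image_mset_mset_set[symmetric]) (simp add: inj_on_def)
  finally show ?case using insert by (simp add: image_mset.compositionality comp_def)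
qed simp

text \<open>Isolates the role of the short pattern: insertion at any \<open>p\<close> preserves
  avoidance of \<open>\<kappa>\<close>, and every avoider arises in this way. Thus
  \<open>\<kappa>\<close> fixes the block sizes, while \<open>\<rho>\<close> restricts
  \<open>p\<close>. Nonemptiness of \<open>\<kappa>\<close> admits the empty word as root.\<close>

definition block_insertions :: "nat list \<Rightarrow> (nat \<Rightarrow> nat) \<Rightarrow> (nat \<Rightarrow> nat) \<Rightarrow> bool" where
  "block_insertions \<kappa> bf ef \<longleftrightarrow> \<kappa> \<noteq> [] \<and> (\<forall>a>0. 0 < bf a \<and> bf a + ef a = a) \<and>
     (\<forall>a>0. \<forall>x w. (\<exists>v p. (\<forall>y\<in>set v. x < y) \<and> avoids_pattern v \<kappa> \<and> p \<le> length v \<and> w = insert_block (bf a) (ef a) x p v)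
        \<longleftrightarrow> (\<forall>y\<in>set w. x \<le> y) \<and> count (mset w) x = a \<and> avoids_pattern w \<kappa>)"

lemma not_contains_Nil: "\<rho> \<noteq> [] \<Longrightarrow> avoids_pattern [] \<rho>"
  by (auto simp: contains_pattern_def)

section \<open>Label distributions, built up letter by letter\<close>

context insertion_rule
begin

text \<open>Each avoider of the enlarged multiset is obtained exactly once, from an avoider over
  \<open>S\<close> and one of its sites; \<open>stat_children\<close> then gives the labels.\<close>

lemma stats_add_min:
  fixes \<kappa> bf ef
  defines "Av \<equiv> \<lambda>S. {w \<in> permutations_of_multiset S. avoids_pattern w \<kappa> \<and> avoids_pattern w \<rho>}"
  assumes \<kappa>: "block_insertions \<kappa> bf ef" and x: "\<forall>y\<in>#S. x < y" and a: "0 < a"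
  shows "image_mset stat (mset_set (Av (replicate_mset a x + S))) =
    \<Sum>\<^sub># (image_mset (child_stats (bf a) (ef a)) (image_mset stat (mset_set (Av S))))"
proof -
  let ?b = "bf a" and ?e = "ef a"
  define ins where "ins = (\<lambda>(w, p). insert_block ?b ?e x p w)"
  have b: "0 < ?b" "?b + ?e = a" using \<kappa> a by (auto simp: block_insertions_def)
  have iff: "(\<exists>v p. (\<forall>y\<in>set v. x < y) \<and> avoids_pattern v \<kappa> \<and> p \<le> length v \<and> w = insert_block ?b ?e x p v)
        \<longleftrightarrow> (\<forall>y\<in>set w. x \<le> y) \<and> count (mset w) x = a \<and> avoids_pattern w \<kappa>" for w
    using \<kappa> a unfolding block_insertions_def by blast
  have mset_ins: "mset (insert_block ?b ?e x p v) = replicate_mset a x + mset v" for p v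
    by (simp add: mset_insert_block b)
  have x0: "x \<notin># S" using x by auto
  have "Av (replicate_mset a x + S) = ins ` (SIGMA w:Av S. sites w)"
  proof (intro equalityI subsetI)
    fix w assume "w \<in> Av (replicate_mset a x + S)"
    then have w: "mset w = replicate_mset a x + S" "avoids_pattern w \<kappa>" "avoids_pattern w \<rho>"
      by (auto simp: Av_def permutations_of_multiset_def)
    have "\<forall>y\<in>#mset w. x \<le> y" using x unfolding w(1) by (auto simp: less_imp_le)
    moreover have "count (mset w) x = a" using x0 unfolding w(1) by (simp add: not_in_iff)
    ultimately obtain v p where v: "\<forall>y\<in>set v. x < y" "avoids_pattern v \<kappa>" "p \<le> length v"
      "w = insert_block ?b ?e x p v"
      using iff[of w] w(2) by auto
    have "mset v = S" using w(1) v(4) mset_ins by simp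
    moreover have "avoids_pattern v \<rho>" "p \<in> sites v"
      using contains_insert_block[OF v(1) b(1) v(3)] w(3) v(4) by auto
    ultimately show "w \<in> ins ` (SIGMA w:Av S. sites w)"
      using v by (auto simp: Av_def permutations_of_multiset_def ins_def)
  next
    fix w assume "w \<in> ins ` (SIGMA w:Av S. sites w)"
    then obtain v p where v: "mset v = S" "avoids_pattern v \<kappa>" "avoids_pattern v \<rho>" "p \<in> sites v"
      "w = insert_block ?b ?e x p v"
      by (auto simp: Av_def permutations_of_multiset_def ins_def)
    have p: "p \<le> length v" using sites_le v(4) by blast
    have min: "\<forall>y\<in>set v. x < y" using x v(1) by auto
    have "avoids_pattern w \<kappa>" using iff[of w] min v p by blast
    moreover have "avoids_pattern w \<rho>"
      using contains_insert_block[OF min b(1) p] v by simp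
    ultimately show "w \<in> Av (replicate_mset a x + S)"
      using v mset_ins by (simp add: Av_def permutations_of_multiset_def)
  qed
  moreover have min: "\<forall>y\<in>set v. x < y" if "v \<in> Av S" for v
    using that x by (auto simp: Av_def permutations_of_multiset_def)
  have "inj_on ins (SIGMA w:Av S. sites w)"
  proof (rule inj_onI, clarify)
    fix v p v' p'
    assume *: "v \<in> Av S" "p \<in> sites v" "v' \<in> Av S" "p' \<in> sites v'" "ins (v, p) = ins (v', p')"
    then have "p \<le> length v" "p' \<le> length v'" using sites_le by blast+
    moreover have "x \<notin> set v" "x \<notin> set v'" using min * by auto
    ultimately show "v = v' \<and> p = p'"
      using insert_block_inject[of x v v' ?b p p' ?e] b(1) *(5) by (simp add: ins_def)
  qed
  ultimately have "image_mset stat (mset_set (Av (replicate_mset a x + S))) =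
     image_mset stat (image_mset ins (mset_set (SIGMA w:Av S. sites w)))"
    by (simp only: image_mset_mset_set)
  also have "\<dots> = image_mset (stat \<circ> ins) (mset_set (SIGMA w:Av S. sites w))"
    by (simp add: image_mset.compositionality)
  also have "\<dots> = (\<Sum>w\<in>Av S. {#(stat \<circ> ins) (w, p). p \<in># mset_set (sites w)#})"
    using finite_subset[OF sites_le] by (intro image_mset_mset_set_Sigma) (auto simp: Av_def)
  also have "\<dots> = (\<Sum>w\<in>Av S. child_stats ?b ?e (stat w))"
    using stat_children[OF min b(1)] by (intro sum.cong) (auto simp: ins_def)
  finally show ?thesis
    by (simp add: sum_unfold_sum_mset image_mset.compositionality comp_def)
qed

lemma stats_empty:
  assumes "\<kappa> \<noteq> []"
  shows "image_mset stat (mset_set {w \<in> permutations_of_multiset {#}. avoids_pattern w \<kappa> \<and> avoids_pattern w \<rho>}) = {#(1, 1)#}"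
proof -
  have "{w \<in> permutations_of_multiset {#}. avoids_pattern w \<kappa> \<and> avoids_pattern w \<rho>} = {[]}"
    using assms pattern_nonempty not_contains_Nil by auto
  moreover have "dsites ([]::nat list) = {0}" by (auto simp: dsites_def)
  moreover from this have "sites [] = {0}" using sites_le[of "[]"] dsites_le[of "[]"] by auto
  ultimately show ?thesis by (simp add: stat_def)
qed

end

text \<open>Whole label distributions are compared, since equal cardinalities alone would not carry
  the induction. \<open>S\<close> ranges over all multisets, because removing the smallest letter of
  a reduced one leaves letters that no longer start at 1.\<close>

lemma m_equivalent_insertion_rules:
  assumes "insertion_rule \<rho> sites" "insertion_rule \<rho>' sites'" and \<kappa>: "block_insertions \<kappa> bf ef"
  shows "m_equivalent {\<kappa>, \<rho>} {\<kappa>, \<rho>'}"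
proof -
  interpret A: insertion_rule \<rho> sites by fact
  interpret B: insertion_rule \<rho>' sites' by fact
  have eq: "image_mset A.stat (mset_set {w \<in> permutations_of_multiset S. avoids_pattern w \<kappa> \<and> avoids_pattern w \<rho>}) =
      image_mset B.stat (mset_set {w \<in> permutations_of_multiset S. avoids_pattern w \<kappa> \<and> avoids_pattern w \<rho>'})" for S
  proof (induction "size S" arbitrary: S rule: less_induct)
    case less
    show ?case
    proof (cases "S = {#}")
      case True
      then show ?thesis using A.stats_empty B.stats_empty \<kappa> by (simp add: block_insertions_def)
    next
      case False
      define x where "x = Min (set_mset S)"
      define T where "T = filter_mset (\<lambda>y. y \<noteq> x) S"
      have x: "x \<in># S" unfolding x_def using False by (intro Min_in) auto
      have S: "S = replicate_mset (count S x) x + T"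
        by (rule multiset_eqI) (simp add: T_def)
      have "size T < size S" using x by (subst S) simp
      then have IH: "image_mset A.stat (mset_set {w \<in> permutations_of_multiset T. avoids_pattern w \<kappa> \<and> avoids_pattern w \<rho>}) =
        image_mset B.stat (mset_set {w \<in> permutations_of_multiset T. avoids_pattern w \<kappa> \<and> avoids_pattern w \<rho>'})"
        by (rule less)
      have min: "\<forall>y\<in>#T. x < y"
      proof
        fix y assume y: "y \<in># T"
        then have "x \<le> y" unfolding x_def by (intro Min_le) (auto simp: T_def)
        then show "x < y" using y by (auto simp: T_def)
      qed
      have "0 < count S x" using x by simp
      from A.stats_add_min[OF \<kappa> min this] B.stats_add_min[OF \<kappa> min this]
      show ?thesis by (simp only: S[symmetric] IH)
    qed
  qed
  \<comment> \<open>Forgetting the labels leaves the number of avoiders.\<close>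
  have "size (image_mset A.stat (mset_set {w \<in> permutations_of_multiset S. avoids_pattern w \<kappa> \<and> avoids_pattern w \<rho>})) =
      size (image_mset B.stat (mset_set {w \<in> permutations_of_multiset S. avoids_pattern w \<kappa> \<and> avoids_pattern w \<rho>'}))" for S
    by (simp only: eq)
  then show ?thesis by (simp add: m_equivalent_def av_def)
qed

section \<open>Words avoiding 121 and words avoiding 112 as block insertions\<close>

lemma eq_replicate: "\<forall>y\<in>set u. y = x \<Longrightarrow> u = replicate (length u) x"
  by (simp add: replicate_length_same)

lemma split_first_run:
  assumes "x \<in> set w"
  obtains ys c u where "w = ys @ replicate (Suc c) x @ u" "x \<notin> set ys" "u = [] \<or> hd u \<noteq> x"
proof -
  obtain ys r where w: "w = ys @ x # r" "x \<notin> set ys" using split_list_first[OF assms] by blast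
  define c where "c = length (takeWhile (\<lambda>y. y = x) r)"
  have "takeWhile (\<lambda>y. y = x) r = replicate c x"
    unfolding c_def by (rule eq_replicate) (auto dest: set_takeWhileD)
  then have "r = replicate c x @ dropWhile (\<lambda>y. y = x) r"
    by (metis takeWhile_dropWhile_id)
  then have "w = ys @ replicate (Suc c) x @ dropWhile (\<lambda>y. y = x) r"
    using w(1) by simp
  moreover have "dropWhile (\<lambda>y. y = x) r = [] \<or> hd (dropWhile (\<lambda>y. y = x) r) \<noteq> x"
    using hd_dropWhile[of "\<lambda>y. y = x" r] by blast
  ultimately show ?thesis using that w(2) by blast
qed

lemma insert_block_append:
  "insert_block b e x (length ys) (ys @ zs) = ys @ replicate b x @ zs @ replicate e x"
  by (simp add: insert_block_def)

lemma block_insertions_121: "block_insertions [1,2,1] (\<lambda>a. a) (\<lambda>a. 0)"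
  unfolding block_insertions_def
proof (intro conjI allI impI)
  fix a x :: nat and w :: "nat list"
  assume a: "0 < a"
  show "(\<exists>v p. (\<forall>y\<in>set v. x < y) \<and> avoids_pattern v [1,2,1] \<and> p \<le> length v \<and> w = insert_block a 0 x p v)
        \<longleftrightarrow> (\<forall>y\<in>set w. x \<le> y) \<and> count (mset w) x = a \<and> avoids_pattern w [1,2,1]"
  proof
    assume "\<exists>v p. (\<forall>y\<in>set v. x < y) \<and> avoids_pattern v [1,2,1] \<and> p \<le> length v \<and> w = insert_block a 0 x p v"
    then obtain v p where v: "\<forall>y\<in>set v. x < y" "avoids_pattern v [1,2,1]" "p \<le> length v"
      "w = insert_block a 0 x p v" by blast
    have x: "x \<notin> set v" using v(1) by auto
    have "\<forall>y\<in>set w. x \<le> y" using v(1) set_insert_block[OF v(1) a v(3), of 0] v(4) by auto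
    moreover have "count (mset w) x = a"
      using x by (simp add: v(4) mset_insert_block count_mset_0_iff)
    moreover have "\<not> subseq [y,c,y] w" if "y < c" for y c
    proof (cases "y = x")
      case True
      \<comment> \<open>An occurrence of \<open>x c x\<close> would lie inside the block, since
        \<open>x\<close> occurs neither before nor after it; but the block contains no
        \<open>c\<close>.\<close>
      have "subseq [x,c,x] w \<longleftrightarrow> subseq ([x,c] @ [x]) ((take p v @ replicate a x) @ drop p v)"
        by (simp add: v(4) insert_block_def)
      also have "\<dots> \<longleftrightarrow> subseq [x,c,x] (take p v @ replicate a x)"
        using x by (subst subseq_strip_right) (auto dest: in_set_dropD)
      also have "\<dots> \<longleftrightarrow> subseq [x,c,x] (replicate a x)"
        using x by (intro subseq_strip_left) (auto dest: in_set_takeD)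
      finally show ?thesis using set_subseq[of "[x,c,x]" "replicate a x"] True that by auto
    next
      case False
      show ?thesis
      proof
        assume *: "subseq [y,c,y] w"
        then have "y \<in> set w" by (rule subseq_Cons_in_set)
        then have "x < y" using \<open>\<forall>y\<in>set w. x \<le> y\<close> False by force
        then have "subseq [y,c,y] v"
          using * subseq_insert_block[OF v(1) a v(3), of "[y,c,y]" 0] that v(4) by simp
        with v(2) that show False unfolding contains_121 by blast
      qed
    qed
    ultimately show "(\<forall>y\<in>set w. x \<le> y) \<and> count (mset w) x = a \<and> avoids_pattern w [1,2,1]"
      unfolding contains_121 by blast
  next
    assume w: "(\<forall>y\<in>set w. x \<le> y) \<and> count (mset w) x = a \<and> avoids_pattern w [1,2,1]"
    then have "x \<in> set w" using a by (metis count_mset_0_iff less_irrefl)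
    then obtain ys c u where s: "w = ys @ replicate (Suc c) x @ u" "x \<notin> set ys" "u = [] \<or> hd u \<noteq> x"
      by (rule split_first_run)
    \<comment> \<open>Otherwise the letter \<open>z\<close> that ends the first run of
      \<open>x\<close> lies between two copies of \<open>x\<close>.\<close>
    have xu: "x \<notin> set u"
    proof
      assume "x \<in> set u"
      then obtain z u' where u: "u = z # u'" "z \<noteq> x" "x \<in> set u'"
        using s(3) by (cases u) auto
      have "z \<in> set w" by (simp add: s(1) u)
      with w u(2) have "x < z" by (simp add: le_neq_implies_less)
      moreover have "subseq ([] @ [x] @ [z,x]) (ys @ replicate (Suc c) x @ u)"
        using u by (intro list_emb_append_mono) (auto simp: subseq_singleton_left)
      ultimately show False using w unfolding contains_121 s(1) by auto
    qed
    have "count (mset ys) x = 0" "count (mset u) x = 0"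
      using s(2) xu by (simp_all only: count_mset_0_iff not_False_eq_True)
    moreover have "count (mset ys) x + (Suc c + count (mset u) x) = a" using w by (simp add: s(1))
    ultimately have "Suc c = a" by linarith
    then have "w = insert_block a 0 x (length ys) (ys @ u)"
      using s(1) insert_block_append[of a 0 x ys u] by simp
    moreover have "\<forall>y\<in>set (ys @ u). x < y"
    proof
      fix y assume "y \<in> set (ys @ u)"
      then have "y \<in> set w" "y \<noteq> x" using s(1,2) xu by auto
      with w show "x < y" by (simp add: le_neq_implies_less)
    qed
    moreover have "subseq (ys @ u) w"
      unfolding s(1) by (intro list_emb_append_mono subseq_drop_many) auto
    then have "avoids_pattern (ys @ u) [1,2,1]"
      using w subseq_order.order_trans unfolding contains_121 by blast
    ultimately show "\<exists>v p. (\<forall>y\<in>set v. x < y) \<and> avoids_pattern v [1,2,1] \<and> p \<le> length v \<and> w = insert_block a 0 x p v"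
      by (intro exI[of _ "ys @ u"] exI[of _ "length ys"]) auto
  qed
qed auto

lemma block_insertions_112: "block_insertions [1,1,2] (\<lambda>a. 1) (\<lambda>a. a - 1)"
  unfolding block_insertions_def
proof (intro conjI allI impI)
  fix a x :: nat and w :: "nat list"
  assume a: "0 < a"
  show "(\<exists>v p. (\<forall>y\<in>set v. x < y) \<and> avoids_pattern v [1,1,2] \<and> p \<le> length v \<and> w = insert_block 1 (a - 1) x p v)
        \<longleftrightarrow> (\<forall>y\<in>set w. x \<le> y) \<and> count (mset w) x = a \<and> avoids_pattern w [1,1,2]"
  proof
    assume "\<exists>v p. (\<forall>y\<in>set v. x < y) \<and> avoids_pattern v [1,1,2] \<and> p \<le> length v \<and> w = insert_block 1 (a - 1) x p v"
    then obtain v p where v: "\<forall>y\<in>set v. x < y" "avoids_pattern v [1,1,2]" "p \<le> length v"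
      "w = insert_block 1 (a - 1) x p v" by blast
    have x: "x \<notin> set v" using v(1) by auto
    have "\<forall>y\<in>set w. x \<le> y" using v(1) set_insert_block[OF v(1) zero_less_one v(3), of "a - 1"] v(4) by auto
    moreover have "count (mset w) x = a"
      using x a by (simp add: v(4) mset_insert_block count_mset_0_iff)
    moreover have "\<not> subseq [y,y,c] w" if "y < c" for y c
    proof (cases "y = x")
      case True
      \<comment> \<open>The first \<open>x\<close> is matched by the inserted one, and
        \<open>c\<close> cannot lie in the trailing block; the part between contains no second
        \<open>x\<close>.\<close>
      have "subseq [x,x,c] w \<longleftrightarrow> subseq [x,c] (drop p v @ replicate (a - 1) x)"
        using x subseq_Cons_first[of x "take p v" "[x,c]"]
        by (auto simp: v(4) insert_block_def dest: in_set_takeD)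
      also have "\<dots> \<longleftrightarrow> subseq [x,c] (drop p v)"
        using subseq_strip_right[of c "replicate (a - 1) x" "[x]"] that True by auto
      finally show ?thesis using x True by (auto dest: subseq_Cons_in_set in_set_dropD)
    next
      case False
      show ?thesis
      proof
        assume *: "subseq [y,y,c] w"
        then have "y \<in> set w" by (rule subseq_Cons_in_set)
        then have "x < y" using \<open>\<forall>y\<in>set w. x \<le> y\<close> False by force
        then have "subseq [y,y,c] v"
          using * subseq_insert_block[OF v(1) zero_less_one v(3), of "[y,y,c]" "a - 1"] that v(4) by simp
        with v(2) that show False unfolding contains_112 by blast
      qed
    qed
    ultimately show "(\<forall>y\<in>set w. x \<le> y) \<and> count (mset w) x = a \<and> avoids_pattern w [1,1,2]"
      unfolding contains_112 by blast
  next
    assume w: "(\<forall>y\<in>set w. x \<le> y) \<and> count (mset w) x = a \<and> avoids_pattern w [1,1,2]"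
    then have "x \<in> set w" using a by (metis count_mset_0_iff less_irrefl)
    then obtain ys r where s: "w = ys @ x # r" "x \<notin> set ys" using split_list_first by metis
    define zs where "zs = takeWhile (\<lambda>y. y \<noteq> x) r"
    define u where "u = dropWhile (\<lambda>y. y \<noteq> x) r"
    have r: "r = zs @ u" by (simp add: zs_def u_def)
    have xz: "x \<notin> set zs" by (auto simp: zs_def dest: set_takeWhileD)
    \<comment> \<open>If nonempty, \<open>u\<close> starts at the second \<open>x\<close>, so any
      other letter in it would complete \<open>x x z\<close>.\<close>
    have "z = x" if z: "z \<in> set u" for z
    proof (rule ccontr)
      assume "z \<noteq> x"
      obtain y u' where yu: "u = y # u'" using z by (cases u) auto
      then have "y = x" unfolding u_def by (simp add: dropWhile_eq_Cons_conv)
      with yu z \<open>z \<noteq> x\<close> have u: "u = x # u'" "z \<in> set u'" by auto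
      have "z \<in> set w" using z by (simp add: s(1) r)
      with w \<open>z \<noteq> x\<close> have "x < z" by (simp add: le_neq_implies_less)
      moreover have "subseq ([] @ [x] @ [] @ [x,z]) (ys @ [x] @ zs @ u)"
        using u by (intro list_emb_append_mono) (auto simp: subseq_singleton_left)
      ultimately show False using w unfolding contains_112 s(1) r by auto
    qed
    then have u: "u = replicate (length u) x" by (intro eq_replicate) blast
    have "count (mset u) x = length u" by (subst u) simp
    moreover have "count (mset ys) x = 0" "count (mset zs) x = 0"
      using s(2) xz by (simp_all only: count_mset_0_iff not_False_eq_True)
    moreover have "count (mset ys) x + Suc (count (mset zs) x + count (mset u) x) = a"
      using w by (simp add: s(1) r)
    ultimately have "length u = a - 1" by linarith
    then have "w = insert_block 1 (a - 1) x (length ys) (ys @ zs)"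
      using s(1) r u insert_block_append[of 1 "a - 1" x ys zs] by simp
    moreover have "\<forall>y\<in>set (ys @ zs). x < y"
    proof
      fix y assume "y \<in> set (ys @ zs)"
      then have "y \<in> set w" "y \<noteq> x" using s r xz by auto
      with w show "x < y" by (simp add: le_neq_implies_less)
    qed
    moreover have "subseq (ys @ zs) w"
      unfolding s(1) r by (intro list_emb_append_mono) auto
    then have "avoids_pattern (ys @ zs) [1,1,2]"
      using w subseq_order.order_trans unfolding contains_112 by blast
    ultimately show "\<exists>v p. (\<forall>y\<in>set v. x < y) \<and> avoids_pattern v [1,1,2] \<and> p \<le> length v \<and> w = insert_block 1 (a - 1) x p v"
      by (intro exI[of _ "ys @ zs"] exI[of _ "length ys"]) auto
  qed
qed auto

theorem theorem2p22:
  shows "m_equivalent {[1,2,1], [1,2,3,3]} {[1,2,1], [2,1,3,3]} \<and>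
         m_equivalent {[1,1,2], [1,2,3,3]} {[1,1,2], [2,1,3,3]}"
  using m_equivalent_insertion_rules[OF rule1233.insertion_rule_axioms rule2133.insertion_rule_axioms]
    block_insertions_121 block_insertions_112 by blast

end
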